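(* Let $n\ge1$, let $X\subset\mathbb{R}^n$, let $r>0$, and let $\sigma$ be a distance-increasing similarity transformation of $\mathbb{R}^n$ with scaling factor $\alpha>1$. Then $e_r(X)=\sigma(X)$ if and only if there is a set $W\subset\mathbb{R}^n$ which is scale-invariant under $\sigma$ (that is, $\sigma(W)=W$) such that $X=e_{r/(\alpha-1)}(W)$.
   Context: Erosion: for $X\subset\mathbb{R}^n$ and $r>0$, $e_r(X)=X\setminus\bigcup_{y\in X^C}B(r,y)$, where $X^C=\mathbb{R}^n\setminus X$ and $B(r,y)$ is the open ball of radius $r$ about $y$; i.e. $e_r(X)$ is the set of points of $X$ at distance $\ge r$ from $X^C$. A similarity transformation is a map $\sigma:\mathbb{R}^n\to\mathbb{R}^n$ for which there is a scaling factor $\alpha>0$ with $|\sigma(x)-\sigma(y)|=\alpha|x-y|$ for all $x,y$; it is distance-increasing if $\alpha>1$. *)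

theory Defs
  imports "HOL-Analysis.Analysis"
begin

definition erosion :: "real \<Rightarrow> 'a::metric_space set \<Rightarrow> 'a set" where
  "erosion r X = X - (\<Union>y\<in>- X. ball y r)"

(* The scaling factor is an explicit argument; on spaces with at least two points
   the map determines it. *)
definition similarity_transformation ::
    "real \<Rightarrow> ('a::metric_space \<Rightarrow> 'a) \<Rightarrow> bool" where
  "similarity_transformation \<alpha> \<sigma> \<longleftrightarrow>
     \<alpha> > 0 \<and> (\<forall>x y. dist (\<sigma> x) (\<sigma> y) = \<alpha> * dist x y)"

definition scale_invariant :: "('a \<Rightarrow> 'a) \<Rightarrow> 'a set \<Rightarrow> bool" where
  "scale_invariant \<sigma> W \<longleftrightarrow> \<sigma> ` W = W"

end

theory Submission
  imports Defs
begin

text \<open>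
Write \<open>\<rho> = r / (\<alpha> - 1)\<close>. Two laws govern erosion: a point lies in the erosion by \<open>s\<close>
exactly when its open \<open>s\<close>-ball lies in the set, so in a normed space eroding by \<open>s\<close> and then by
\<open>r\<close> is eroding by \<open>r + s\<close> (\<open>erosion_erosion\<close>); and a surjective similarity carries the
erosion by \<open>s\<close> to the erosion of the image by \<open>\<alpha> s\<close> (\<open>image_erosion\<close>). The radius \<open>\<rho>\<close>
is the solution of \<open>r + \<rho> = \<alpha> \<rho>\<close>, so if \<open>X\<close> is the erosion of an invariant \<open>W\<close> by \<open>\<rho>\<close>,
then the erosion of \<open>X\<close> by \<open>r\<close> and the image of \<open>X\<close> are both the erosion of \<open>W\<close> by
\<open>\<alpha> \<rho>\<close>.

Conversely, suppose that \<open>\<sigma>\<close> maps \<open>X\<close> onto its erosion by \<open>r\<close>. Then \<open>X\<close> is mapped into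
itself, its preimages under the powers of \<open>\<sigma>\<close> increase, and their union \<open>W\<close> is invariant.
Iterating the hypothesis exhibits \<open>X\<close> as the erosion of its \<open>k\<close>-th preimage by
\<open>r / \<alpha> + \<dots> + r / \<alpha>\<^sup>k\<close>, which tends to \<open>\<rho>\<close>; hence the \<open>\<rho>\<close>-ball about each point of
\<open>X\<close> lies in \<open>W\<close>. The remaining point is that the \<open>\<rho>\<close>-ball about a point \<open>x\<close> outside
\<open>X\<close> leaves \<open>W\<close>. By hypothesis the \<open>k\<close>-th preimage of the complement of \<open>X\<close> has, near each
of its points, a point of the next preimage at distance less than \<open>r / \<alpha>\<^bsup>k+1\<^esup>\<close>. Starting from
\<open>x\<close> this gives a Cauchy sequence whose limit avoids \<open>W\<close>, because \<open>W\<close> is an increasing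
union of sets each lying in the interior of the next; and since the first step is strictly shorter
than its bound, the limit has distance strictly less than \<open>\<rho>\<close> from \<open>x\<close>. These two directions
of the equation for \<open>X\<close> make up \<open>eroded_by_similarity_imp_erosion_of_invariant\<close>.
\<close>

section \<open>Erosions and balls\<close>

lemma mem_erosion_iff:
  assumes "r > 0"
  shows "x \<in> erosion r X \<longleftrightarrow> ball x r \<subseteq> X"
proof
  assume "x \<in> erosion r X"
  then show "ball x r \<subseteq> X"
    by (fastforce simp: erosion_def dist_commute)
next
  assume "ball x r \<subseteq> X"
  moreover have "x \<in> ball x r" using assms by simp
  ultimately show "x \<in> erosion r X"
    by (auto simp: erosion_def subset_iff dist_commute)
qed

text \<open>
The inclusion from right to left uses segments: a point of the large ball is reached through the
point dividing the segment from the centre in the ratio \<open>r : s\<close>. In a general metric space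
only the other inclusion holds.
\<close>

lemma Union_balls_around_ball:
  fixes x :: "'a::real_normed_vector"
  assumes "r > 0" and "s > 0"
  shows "(\<Union>y\<in>ball x r. ball y s) = ball x (r + s)"
proof
  show "(\<Union>y\<in>ball x r. ball y s) \<subseteq> ball x (r + s)"
  proof clarify
    fix y z assume "y \<in> ball x r" "z \<in> ball y s"
    then show "z \<in> ball x (r + s)"
      using dist_triangle[of x z y] by simp
  qed
next
  show "ball x (r + s) \<subseteq> (\<Union>y\<in>ball x r. ball y s)"
  proof
    fix z assume z: "z \<in> ball x (r + s)"
    define t where "t = r / (r + s)"
    define y where "y = x + t *\<^sub>R (z - x)"
    have t: "0 < t" "0 < 1 - t" "t * (r + s) = r" "(1 - t) * (r + s) = s"
      using assms by (simp_all add: t_def field_simps)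
    have "y - x = t *\<^sub>R (z - x)" and "z - y = (1 - t) *\<^sub>R (z - x)"
      by (simp_all add: y_def algebra_simps)
    then have "dist y x = t * dist z x" and "dist z y = (1 - t) * dist z x"
      using t by (simp_all add: dist_norm)
    then have "dist x y = t * dist x z" and "dist y z = (1 - t) * dist x z"
      by (simp_all only: dist_commute)
    with z t have "dist x y < t * (r + s)" and "dist y z < (1 - t) * (r + s)"
      by (metis mem_ball mult_strict_left_mono)+
    then have "y \<in> ball x r" and "z \<in> ball y s"
      using t by simp_all
    then show "z \<in> (\<Union>y\<in>ball x r. ball y s)" by blast
  qed
qed

lemma erosion_erosion:
  fixes X :: "'a::real_normed_vector set"
  assumes "r > 0" and "s > 0"
  shows "erosion r (erosion s X) = erosion (r + s) X"
proof (rule set_eqI)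
  fix x
  have "x \<in> erosion r (erosion s X) \<longleftrightarrow> (\<forall>y\<in>ball x r. ball y s \<subseteq> X)"
    unfolding mem_erosion_iff[OF assms(1)] subset_eq[of "ball x r"] mem_erosion_iff[OF assms(2)] ..
  also have "\<dots> \<longleftrightarrow> ball x (r + s) \<subseteq> X"
    using Union_balls_around_ball[OF assms, of x] UN_subset_iff by metis
  also have "\<dots> \<longleftrightarrow> x \<in> erosion (r + s) X"
    using assms by (simp add: mem_erosion_iff)
  finally show "x \<in> erosion r (erosion s X) \<longleftrightarrow> x \<in> erosion (r + s) X" .
qed

section \<open>Similarities\<close>

lemma similarity_funpow_dist:
  assumes "similarity_transformation \<alpha> \<sigma>"
  shows "dist ((\<sigma> ^^ k) x) ((\<sigma> ^^ k) y) = \<alpha> ^ k * dist x y"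
  using assms by (induction k) (simp_all add: similarity_transformation_def)

lemma similarity_inj:
  assumes "similarity_transformation \<alpha> \<sigma>"
  shows "inj \<sigma>"
proof (rule injI)
  fix x y assume "\<sigma> x = \<sigma> y"
  then have "\<alpha> * dist x y = 0"
    using assms by (metis dist_self similarity_transformation_def)
  then show "x = y"
    using assms by (simp add: similarity_transformation_def)
qed

text \<open>
Moving the image of the origin back to the origin and dividing by the scaling factor leaves a
distance-preserving map that fixes the origin; in a Euclidean space such a map is an orthogonal
linear map, hence onto.
\<close>

lemma similarity_surj:
  fixes \<sigma> :: "'a::euclidean_space \<Rightarrow> 'a"
  assumes "similarity_transformation \<alpha> \<sigma>"
  shows "surj \<sigma>"
proof -
  have \<alpha>: "\<alpha> > 0" and d: "\<And>x y. dist (\<sigma> x) (\<sigma> y) = \<alpha> * dist x y"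
    using assms by (auto simp: similarity_transformation_def)
  define f where "f x = (\<sigma> x - \<sigma> 0) /\<^sub>R \<alpha>" for x
  have "dist (f x) (f y) = dist x y" for x y
  proof -
    have "f x - f y = (\<sigma> x - \<sigma> y) /\<^sub>R \<alpha>"
      by (simp add: f_def algebra_simps)
    then show ?thesis
      using \<alpha> d[of x y] by (simp add: dist_norm)
  qed
  moreover have "f 0 = 0" by (simp add: f_def)
  ultimately have "surj f"
    by (meson orthogonal_transformation_isometry orthogonal_transformation_surj)
  show ?thesis
  proof (rule surjI)
    fix y
    have "f (inv f ((y - \<sigma> 0) /\<^sub>R \<alpha>)) = (y - \<sigma> 0) /\<^sub>R \<alpha>"
      using \<open>surj f\<close> by (rule surj_f_inv_f)
    then show "\<sigma> (inv f ((y - \<sigma> 0) /\<^sub>R \<alpha>)) = y"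
      using \<alpha> by (simp add: f_def)
  qed
qed

text \<open>
Surjectivity matters: it makes the image of an open ball a full open ball of the larger radius.
\<close>

lemma image_erosion:
  assumes \<sigma>: "similarity_transformation \<alpha> \<sigma>" and "surj \<sigma>" and "s > 0"
  shows "\<sigma> ` erosion s X = erosion (\<alpha> * s) (\<sigma> ` X)"
proof -
  have \<alpha>: "\<alpha> > 0" and d: "\<And>x y. dist (\<sigma> x) (\<sigma> y) = \<alpha> * dist x y"
    using \<sigma> by (auto simp: similarity_transformation_def)
  have balls: "\<sigma> ` ball x s = ball (\<sigma> x) (\<alpha> * s)" for x
  proof
    show "\<sigma> ` ball x s \<subseteq> ball (\<sigma> x) (\<alpha> * s)"
      using \<alpha> by (auto simp: d)
    show "ball (\<sigma> x) (\<alpha> * s) \<subseteq> \<sigma> ` ball x s"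
    proof
      fix y assume y: "y \<in> ball (\<sigma> x) (\<alpha> * s)"
      obtain z where "y = \<sigma> z" using \<open>surj \<sigma>\<close> by (metis surjD)
      with y \<alpha> show "y \<in> \<sigma> ` ball x s" by (simp add: d)
    qed
  qed
  have mem: "\<sigma> x \<in> erosion (\<alpha> * s) (\<sigma> ` X) \<longleftrightarrow> x \<in> erosion s X" for x
    using \<alpha> \<open>s > 0\<close> similarity_inj[OF \<sigma>]
    by (simp add: mem_erosion_iff balls[symmetric] inj_image_subset_iff)
  show ?thesis
  proof (intro set_eqI)
    fix y
    obtain x where "y = \<sigma> x" using \<open>surj \<sigma>\<close> by (metis surjD)
    then show "y \<in> \<sigma> ` erosion s X \<longleftrightarrow> y \<in> erosion (\<alpha> * s) (\<sigma> ` X)"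
      using mem similarity_inj[OF \<sigma>] by (simp add: inj_image_mem_iff)
  qed
qed

section \<open>Sets mapped onto their erosion\<close>

text \<open>
The estimate at every index, not just the first, serves two purposes below: at index 1 it measures
the part of the path after the first step, and for large indices it gives convergence.
\<close>

lemma geometric_steps_converge:
  fixes u :: "nat \<Rightarrow> 'a::complete_space"
  assumes q: "0 < q" "q < 1"
    and step: "\<And>k. dist (u k) (u (Suc k)) \<le> C * q ^ k"
  obtains l where "\<And>k. dist (u k) l \<le> C / (1 - q) * q ^ k"
proof -
  have C: "C \<ge> 0" using step[of 0] order_trans[OF zero_le_dist] by fastforce
  have bound: "dist (u m) (u (m + n)) \<le> C / (1 - q) * q ^ m" for m n
  proof -
    have "dist (u m) (u (m + n)) \<le> C / (1 - q) * (q ^ m - q ^ (m + n))"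
    proof (induction n)
      case (Suc n)
      have "C / (1 - q) * (q ^ (m + n) - q ^ (m + Suc n)) = C * q ^ (m + n)"
        using q by (simp add: field_simps)
      then show ?case
        using Suc step[of "m + n"] dist_triangle[of "u m" "u (m + Suc n)" "u (m + n)"]
        by (simp add: right_diff_distrib)
    qed simp
    also have "\<dots> \<le> C / (1 - q) * q ^ m"
      using q C by (intro mult_left_mono) simp_all
    finally show ?thesis .
  qed
  have lim: "(\<lambda>m. C / (1 - q) * q ^ m) \<longlonglongrightarrow> 0"
    using q by (intro tendsto_mult_right_zero LIMSEQ_realpow_zero) simp_all
  have "Cauchy u"
  proof (rule metric_CauchyI)
    fix e :: real assume "0 < e"
    then have "\<forall>\<^sub>F m in sequentially. C / (1 - q) * q ^ m < e / 2"
      using order_tendstoD(2)[OF lim, of "e / 2"] by simp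
    then obtain M where M: "C / (1 - q) * q ^ M < e / 2"
      by (auto simp: eventually_sequentially)
    have "dist (u M) (u n) < e / 2" if "n \<ge> M" for n
      using le_less_trans[OF bound[of M "n - M"] M] that by simp
    then have "dist (u m) (u n) < e" if "m \<ge> M" "n \<ge> M" for m n
      using that dist_triangle_half_r by blast
    then show "\<exists>M. \<forall>m\<ge>M. \<forall>n\<ge>M. dist (u m) (u n) < e" by blast
  qed
  then obtain l where l: "u \<longlonglongrightarrow> l"
    using Cauchy_convergent convergent_def by blast
  have "dist (u k) l \<le> C / (1 - q) * q ^ k" for k
  proof (rule LIMSEQ_le_const2)
    show "(\<lambda>n. dist (u k) (u (k + n))) \<longlonglongrightarrow> dist (u k) l"
      by (intro tendsto_intros) (use LIMSEQ_ignore_initial_segment[OF l, of k] in \<open>simp add: add.commute\<close>)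
  qed (use bound in blast)
  then show thesis by (rule that)
qed

text \<open>
The set \<open>W\<close> consists of the points whose orbit under \<open>\<sigma>\<close> reaches \<open>X\<close>. It is the least
candidate: a set contains its erosions, and an invariant set containing \<open>X\<close> contains every
preimage of \<open>X\<close> under a power of the injective map \<open>\<sigma>\<close>. Completeness supplies the point outside \<open>W\<close> that keeps a given point outside
the erosion of \<open>W\<close>.
\<close>

lemma eroded_by_similarity_imp_erosion_of_invariant:
  fixes X :: "'a::banach set"
  assumes \<sigma>: "similarity_transformation \<alpha> \<sigma>" and "surj \<sigma>"
    and \<alpha>: "\<alpha> > 1" and r: "r > 0"
    and eq: "erosion r X = \<sigma> ` X"
  defines "W \<equiv> \<Union>k. (\<sigma> ^^ k) -` X"
  shows "scale_invariant \<sigma> W" and "X = erosion (r / (\<alpha> - 1)) W"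
proof -
  define \<rho> where "\<rho> = r / (\<alpha> - 1)"
  have \<rho>: "\<rho> > 0" using \<alpha> r by (simp add: \<rho>_def)
  have \<sigma>_mem: "\<sigma> x \<in> X" if "x \<in> X" for x
    using eq that by (auto simp: erosion_def)
  have pow_mem: "(\<sigma> ^^ k) x \<in> X" if "x \<in> X" for x k
    using that by (induction k) (simp_all add: \<sigma>_mem)
  have surj_pow: "surj (\<sigma> ^^ k)" for k
    using \<open>surj \<sigma>\<close> by (rule surj_fn)
  note dist_pow = similarity_funpow_dist[OF \<sigma>]
  have ball_mem: "ball (\<sigma> x) r \<subseteq> X" if "x \<in> X" for x
    using that eq r mem_erosion_iff by blast

  have "\<sigma> -` W = W"
  proof
    show "\<sigma> -` W \<subseteq> W"
    proof
      fix x assume "x \<in> \<sigma> -` W"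
      then obtain k where "(\<sigma> ^^ k) (\<sigma> x) \<in> X" by (auto simp: W_def)
      then have "(\<sigma> ^^ Suc k) x \<in> X" by (simp add: funpow_swap1)
      then show "x \<in> W" unfolding W_def by blast
    qed
    show "W \<subseteq> \<sigma> -` W"
    proof
      fix x assume "x \<in> W"
      then obtain k where "(\<sigma> ^^ k) x \<in> X" by (auto simp: W_def)
      then have "(\<sigma> ^^ k) (\<sigma> x) \<in> X" using \<sigma>_mem by (simp add: funpow_swap1[symmetric])
      then show "x \<in> \<sigma> -` W" unfolding W_def by blast
    qed
  qed
  then show "scale_invariant \<sigma> W"
    unfolding scale_invariant_def using \<open>surj \<sigma>\<close> by (metis surj_image_vimage_eq)

  \<comment> \<open>The radii accumulate as \<open>r (1 + \<alpha> + \<alpha>\<^sup>2 + \<dots>)\<close>, a geometric sum with the closed form below.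
    It starts with one application of \<open>\<sigma>\<close>, where the radius is already positive.\<close>
  have image_pow: "(\<sigma> ^^ Suc k) ` X = erosion (\<rho> * (\<alpha> ^ Suc k - 1)) X" for k
  proof (induction k)
    case 0
    then show ?case using eq \<alpha> by (simp add: \<rho>_def)
  next
    case (Suc k)
    define a where "a = \<rho> * (\<alpha> ^ Suc k - 1)"
    have a: "a > 0" using \<rho> one_less_power[OF \<alpha>, of "Suc k"] by (simp add: a_def)
    have "r = \<rho> * (\<alpha> - 1)" using \<alpha> by (simp add: \<rho>_def)
    then have sum: "\<alpha> * a + r = \<rho> * (\<alpha> ^ Suc (Suc k) - 1)"
      by (simp add: a_def algebra_simps)
    have "(\<sigma> ^^ Suc (Suc k)) ` X = \<sigma> ` erosion a X"
      using Suc unfolding a_def by (simp only: funpow.simps image_comp[symmetric])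
    also have "\<dots> = erosion (\<alpha> * a) (erosion r X)"
      unfolding eq by (rule image_erosion[OF \<sigma> \<open>surj \<sigma>\<close> a])
    also have "\<dots> = erosion (\<alpha> * a + r) X"
      using a \<alpha> r by (intro erosion_erosion) simp_all
    finally show ?case unfolding sum .
  qed

  have pull_in: "ball x \<rho> \<subseteq> W" if "x \<in> X" for x
  proof
    fix z assume z: "z \<in> ball x \<rho>"
    have "(\<lambda>k. \<rho> * (1 - (1 / \<alpha>) ^ Suc k)) \<longlonglongrightarrow> \<rho> * (1 - 0)"
      using \<alpha> by (intro tendsto_intros LIMSEQ_Suc LIMSEQ_realpow_zero) simp_all
    then have "\<forall>\<^sub>F k in sequentially. dist x z < \<rho> * (1 - (1 / \<alpha>) ^ Suc k)"
      using z by (intro order_tendstoD(1)) simp_all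
    then obtain k where "dist x z < \<rho> * (1 - (1 / \<alpha>) ^ Suc k)"
      by (auto simp: eventually_sequentially)
    then have "\<alpha> ^ Suc k * dist x z < \<alpha> ^ Suc k * (\<rho> * (1 - (1 / \<alpha>) ^ Suc k))"
      using \<alpha> by (intro mult_strict_left_mono) simp_all
    also have "\<dots> = \<rho> * (\<alpha> ^ Suc k - 1)"
      using \<alpha> by (simp add: field_simps)
    finally have "(\<sigma> ^^ Suc k) z \<in> ball ((\<sigma> ^^ Suc k) x) (\<rho> * (\<alpha> ^ Suc k - 1))"
      unfolding mem_ball dist_pow .
    moreover have "\<dots> \<subseteq> X"
    proof -
      have "(\<sigma> ^^ Suc k) x \<in> erosion (\<rho> * (\<alpha> ^ Suc k - 1)) X"
        unfolding image_pow[symmetric] using that by (rule imageI)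
      moreover have "\<rho> * (\<alpha> ^ Suc k - 1) > 0"
        using \<rho> one_less_power[OF \<alpha>, of "Suc k"] by simp
      ultimately show ?thesis using mem_erosion_iff by blast
    qed
    ultimately have "(\<sigma> ^^ Suc k) z \<in> X" by blast
    then show "z \<in> W" unfolding W_def by blast
  qed
  have escape: "\<exists>l. l \<notin> W \<and> dist x l < \<rho>" if "x \<notin> X" for x
  proof -
    have "\<exists>y. \<forall>k. (y k \<notin> X \<and> (k = 0 \<longrightarrow> y k = x)) \<and> dist (\<sigma> (y k)) (y (Suc k)) < r"
    proof (rule dependent_nat_choice)
      show "\<exists>y. y \<notin> X \<and> ((0::nat) = 0 \<longrightarrow> y = x)" using that by blast
    next
      fix y and k :: nat assume "y \<notin> X \<and> (k = 0 \<longrightarrow> y = x)"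
      then have "\<sigma> y \<notin> erosion r X"
        using eq similarity_inj[OF \<sigma>] by (simp add: inj_image_mem_iff)
      then obtain z where "z \<notin> X" "dist (\<sigma> y) z < r"
        unfolding mem_erosion_iff[OF r] subset_iff by auto
      then show "\<exists>z. (z \<notin> X \<and> (Suc k = 0 \<longrightarrow> z = x)) \<and> dist (\<sigma> y) z < r" by blast
    qed
    then obtain y where y: "y 0 = x" "\<And>k. y k \<notin> X" "\<And>k. dist (\<sigma> (y k)) (y (Suc k)) < r"
      by blast
    \<comment> \<open>Pulled back to the scale of \<open>x\<close>, the steps of the sequence shrink geometrically.\<close>
    define w where "w k = inv (\<sigma> ^^ k) (y k)" for k
    have w: "(\<sigma> ^^ k) (w k) = y k" for k
      unfolding w_def by (rule surj_f_inv_f[OF surj_pow])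
    have step: "dist (w k) (w (Suc k)) < r / \<alpha> * (1 / \<alpha>) ^ k" for k
    proof -
      have "\<alpha> ^ Suc k * dist (w k) (w (Suc k)) = dist (\<sigma> (y k)) (y (Suc k))"
        by (metis dist_pow w funpow.simps(2) o_apply)
      with y(3)[of k] have "\<alpha> ^ Suc k * dist (w k) (w (Suc k)) < r" by simp
      then show ?thesis using \<alpha> by (simp add: field_simps)
    qed
    have "r / \<alpha> / (1 - 1 / \<alpha>) = \<rho>" using \<alpha> by (simp add: \<rho>_def field_simps)
    then obtain l where l: "\<And>k. dist (w k) l \<le> \<rho> * (1 / \<alpha>) ^ k"
      using geometric_steps_converge[of "1 / \<alpha>" w "r / \<alpha>"] step \<alpha>
      by (metis divide_less_eq_1_pos divide_pos_pos less_eq_real_def less_trans zero_less_one)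
    \<comment> \<open>The first step is kept apart from the rest because only its bound is strict; the limit
      turns the other bounds into weak ones.\<close>
    have "dist x l \<le> dist (w 0) (w 1) + dist (w 1) l"
      using y(1) w[of 0] dist_triangle by simp
    also have "\<dots> < r / \<alpha> + \<rho> / \<alpha>"
      using step[of 0] l[of 1] by simp
    also have "\<dots> = \<rho>" using \<alpha> by (simp add: \<rho>_def field_simps)
    finally have "dist x l < \<rho>" .
    moreover have "l \<notin> W"
    proof
      assume "l \<in> W"
      then obtain m where m: "(\<sigma> ^^ m) l \<in> X" by (auto simp: W_def)
      \<comment> \<open>The next preimage of \<open>X\<close> contains a whole ball about \<open>l\<close>, so it captures \<open>w k\<close>
        for large \<open>k\<close>, which pushes \<open>y k\<close> into \<open>X\<close>.\<close>
      have "(\<lambda>k. \<rho> * (1 / \<alpha>) ^ k) \<longlonglongrightarrow> 0"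
        using \<alpha> by (intro tendsto_mult_right_zero LIMSEQ_realpow_zero) simp_all
      then have "\<forall>\<^sub>F k in sequentially. \<rho> * (1 / \<alpha>) ^ k < r / \<alpha> ^ Suc m"
        by (rule order_tendstoD(2)) (use r \<alpha> in \<open>intro divide_pos_pos zero_less_power; simp\<close>)
      then obtain k where k: "k \<ge> Suc m" "\<rho> * (1 / \<alpha>) ^ k < r / \<alpha> ^ Suc m"
        unfolding eventually_sequentially by (meson max.cobounded1 max.cobounded2)
      have "dist l (w k) < r / \<alpha> ^ Suc m"
        using l[of k] k(2) by (simp add: dist_commute)
      then have "dist ((\<sigma> ^^ Suc m) l) ((\<sigma> ^^ Suc m) (w k)) < r"
        using \<alpha> unfolding dist_pow by (simp add: field_simps)
      then have "(\<sigma> ^^ Suc m) (w k) \<in> X"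
        using ball_mem[OF m] by auto
      then have "(\<sigma> ^^ (k - Suc m)) ((\<sigma> ^^ Suc m) (w k)) \<in> X" by (rule pow_mem)
      also have "(\<sigma> ^^ (k - Suc m)) ((\<sigma> ^^ Suc m) (w k)) = y k"
        using k(1) w[of k] by (metis funpow_add le_add_diff_inverse2 o_apply)
      finally show False using y(2) by blast
    qed
    ultimately show ?thesis by blast
  qed
  show "X = erosion (r / (\<alpha> - 1)) W"
  proof (rule set_eqI)
    fix x
    have "x \<in> X \<longleftrightarrow> ball x \<rho> \<subseteq> W"
      using pull_in[of x] escape[of x] mem_ball by blast
    then show "x \<in> X \<longleftrightarrow> x \<in> erosion (r / (\<alpha> - 1)) W"
      unfolding \<rho>_def[symmetric] mem_erosion_iff[OF \<rho>] .
  qed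
qed

section \<open>Characterisation by invariant sets\<close>

theorem theorem4p6:
  fixes X :: "(real ^ 'n) set"
    and \<sigma> :: "real ^ 'n \<Rightarrow> real ^ 'n"
    and r \<alpha> :: real
  assumes "r > 0"
    and "similarity_transformation \<alpha> \<sigma>"
    and "\<alpha> > 1"
  shows "erosion r X = \<sigma> ` X \<longleftrightarrow>
    (\<exists>W. scale_invariant \<sigma> W \<and> X = erosion (r / (\<alpha> - 1)) W)"
proof
  have surj: "surj \<sigma>" using assms(2) by (rule similarity_surj)
  show "\<exists>W. scale_invariant \<sigma> W \<and> X = erosion (r / (\<alpha> - 1)) W"
    if "erosion r X = \<sigma> ` X"
    using eroded_by_similarity_imp_erosion_of_invariant[OF assms(2) surj assms(3,1) that]
    by blast
  show "erosion r X = \<sigma> ` X"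
    if exW: "\<exists>W. scale_invariant \<sigma> W \<and> X = erosion (r / (\<alpha> - 1)) W"
  proof -
    define \<rho> where "\<rho> = r / (\<alpha> - 1)"
    \<comment> \<open>\<open>\<rho>\<close> is the radius at which eroding further by \<open>r\<close> amounts to scaling by \<open>\<alpha>\<close>.\<close>
    have \<rho>: "\<rho> > 0" "r + \<rho> = \<alpha> * \<rho>"
      using assms by (simp_all add: \<rho>_def field_simps)
    obtain W where "scale_invariant \<sigma> W" and "X = erosion (r / (\<alpha> - 1)) W"
      using exW by blast
    then have W: "\<sigma> ` W = W" "X = erosion \<rho> W"
      unfolding scale_invariant_def \<rho>_def .
    have "erosion r X = erosion (\<alpha> * \<rho>) (\<sigma> ` W)"
      unfolding W erosion_erosion[OF assms(1) \<rho>(1)] \<rho>(2) ..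
    also have "\<dots> = \<sigma> ` X"
      unfolding W(2) by (rule image_erosion[OF assms(2) surj \<rho>(1), symmetric])
    finally show ?thesis .
  qed
qed

end
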